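(* Let $\lambda \in P^+$. There is a natural bijection between the set of embeddings of type $\lambda$ into $U_q(\mathfrak g)$ and the set $\{\, M(v) \subset U_q(\mathfrak g) \mid v \in F_S(\lambda)\,\}$ of $U_q(\mathfrak l_S)$-submodules of $U_q(\mathfrak g)$ that are isomorphic to $V(\lambda)$.
   Context: Let $\mathfrak g$ be a complex semisimple Lie algebra with Cartan subalgebra $\mathfrak h$, simple roots $\alpha_1,\dots,\alpha_r$ and corresponding fundamental weights $\varpi_1,\dots,\varpi_r$. Let $Q$ be the integral root lattice, $P$ the integral weight lattice, and $P^+\subset P$ the set of dominant integral weights of $\mathfrak g$. The Killing form induces a bilinear pairing $\langle\cdot,\cdot\rangle$ on $P\times P$ with $\langle\varpi_i,\alpha_j\rangle=\delta_{ij}d_i$. $U_q(\mathfrak g)$ is the quantized enveloping algebra of $\mathfrak g$, with generators $E_i,F_i,K_i,K_i^{-1}$ subject to the standard relations, and with Hopf algebra structure whose coproduct satisfies $\Delta(E_i)=E_i\otimes 1+K_i\otimes E_i$, $\Delta(F_i)=F_i\otimes K_i^{-1}+1\otimes F_i$, $\Delta(K_i)=K_i\otimes K_i$. The left adjoint action of $U_q(\mathfrak g)$ on itself is $\operatorname{ad}_L(a)(b)=a_{(1)}\,b\,\sigma(a_{(2)})$ (Sweedler notation), where $\sigma$ denotes the antipode. For a subset $\{\alpha_i\}_{i\in S}$ of the simple roots, the quantum Levi subalgebra $U_q(\mathfrak l_S)$ is the Hopf subalgebra generated by $E_i,F_i$ ($i\in S$) and $K_j^{\pm1}$ ($j=1,\dots,r$).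 It acts on $U_q(\mathfrak g)$ by $\operatorname{ad}_L$, and submodules of $U_q(\mathfrak g)$ are taken with respect to this action. The relative locally finite part is $F_S=\{v\in U_q(\mathfrak g)\mid \dim \operatorname{ad}_L(U_q(\mathfrak l_S))\cdot v<\infty\}$, where $\operatorname{ad}_L(U_q(\mathfrak l_S))\cdot v=\{\operatorname{ad}_L(a)(v)\mid a\in U_q(\mathfrak l_S)\}$. For $v\in F_S$, the cyclic adjoint module generated by $v$ is $M(v)=\operatorname{ad}_L(U_q(\mathfrak l_S))\cdot v$. For $\lambda\in P^+$, $V(\lambda)$ denotes the finite-dimensional irreducible $U_q(\mathfrak l_S)$-module of highest weight $\lambda$, and $F_S(\lambda)=\{v\in F_S\mid M(v)\simeq V(\lambda)\}$. An embedding of type $\lambda$ into $U_q(\mathfrak g)$ means a $U_q(\mathfrak l_S)$-submodule $M\subset U_q(\mathfrak g)$ such that $M\simeq V(\lambda)$ as $U_q(\mathfrak l_S)$-modules. The natural bijection is the one sending a submodule to itself. *)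

theory Defs
  imports Complex_Main "HOL-Library.Poly_Mapping"
begin

section \<open>Semisimple Lie algebras, simple roots and dominant weights\<close>

locale complex_lie_algebra = vector_space scale
  for scale :: "complex \<Rightarrow> 'g::ab_group_add \<Rightarrow> 'g" +
  fixes bracket :: "'g \<Rightarrow> 'g \<Rightarrow> 'g"
  assumes finite_dim: "\<exists>B. finite B \<and> span B = UNIV"
    and bracket_add_left: "bracket (x + y) z = bracket x z + bracket y z"
    and bracket_add_right: "bracket x (y + z) = bracket x y + bracket x z"
    and bracket_scale_left: "bracket (scale c x) y = scale c (bracket x y)"
    and bracket_scale_right: "bracket x (scale c y) = scale c (bracket x y)"
    and bracket_self: "bracket x x = 0"
    and jacobi: "bracket x (bracket y z) + bracket y (bracket z x) + bracket z (bracket x y) = 0"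
begin

definition bracket_span :: "'g set \<Rightarrow> 'g set \<Rightarrow> 'g set" where
  "bracket_span A B = span {bracket x y | x y. x \<in> A \<and> y \<in> B}"

definition lie_ideal :: "'g set \<Rightarrow> bool" where
  "lie_ideal I \<longleftrightarrow> subspace I \<and> (\<forall>x. \<forall>y\<in>I. bracket x y \<in> I)"

definition lie_solvable :: "'g set \<Rightarrow> bool" where
  "lie_solvable I \<longleftrightarrow> (\<exists>n. ((\<lambda>A. bracket_span A A) ^^ n) I = {0})"

definition lie_nilpotent :: "'g set \<Rightarrow> bool" where
  "lie_nilpotent L \<longleftrightarrow> (\<exists>n. ((\<lambda>A. bracket_span L A) ^^ n) L = {0})"

definition semisimple :: bool where
  "semisimple \<longleftrightarrow> (\<forall>I. lie_ideal I \<and> lie_solvable I \<longrightarrow> I = {0})"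

definition cartan_subalgebra :: "'g set \<Rightarrow> bool" where
  "cartan_subalgebra h \<longleftrightarrow> subspace h \<and> (\<forall>x\<in>h. \<forall>y\<in>h. bracket x y \<in> h)
     \<and> lie_nilpotent h \<and> {x. \<forall>y\<in>h. bracket x y \<in> h} \<subseteq> h"

text \<open>The trace is computed in an arbitrary basis; \<^term>\<open>extend_basis {}\<close> is one.\<close>

definition endo_trace :: "('g \<Rightarrow> 'g) \<Rightarrow> complex" where
  "endo_trace f = (\<Sum>b\<in>extend_basis {}. representation (extend_basis {}) (f b) b)"

definition killing_form :: "'g \<Rightarrow> 'g \<Rightarrow> complex" where
  "killing_form x y = endo_trace (\<lambda>z. bracket x (bracket y z))"

text \<open>Functionals on \<open>h\<close> are represented by functions that vanish outside \<open>h\<close>.\<close>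

definition dual_space :: "'g set \<Rightarrow> ('g \<Rightarrow> complex) set" where
  "dual_space h = {f. (\<forall>x\<in>h. \<forall>y\<in>h. f (x + y) = f x + f y)
     \<and> (\<forall>c. \<forall>x\<in>h. f (scale c x) = c * f x) \<and> (\<forall>x. x \<notin> h \<longrightarrow> f x = 0)}"

definition root_space :: "'g set \<Rightarrow> ('g \<Rightarrow> complex) \<Rightarrow> 'g set" where
  "root_space h \<beta> = {x. \<forall>H\<in>h. bracket H x = scale (\<beta> H) x}"

definition roots :: "'g set \<Rightarrow> ('g \<Rightarrow> complex) set" where
  "roots h = {\<beta> \<in> dual_space h. \<beta> \<noteq> (\<lambda>_. 0) \<and> root_space h \<beta> \<noteq> {0}}"

definition simple_roots :: "'g set \<Rightarrow> ('i::finite \<Rightarrow> 'g \<Rightarrow> complex) \<Rightarrow> bool" where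
  "simple_roots h \<alpha> \<longleftrightarrow> range \<alpha> \<subseteq> roots h
     \<and> (\<forall>c. (\<forall>x. (\<Sum>i\<in>UNIV. c i * \<alpha> i x) = 0) \<longrightarrow> (\<forall>i. c i = 0))
     \<and> (\<forall>\<beta>\<in>roots h. \<exists>n :: 'i \<Rightarrow> nat.
          \<beta> = (\<lambda>x. \<Sum>i\<in>UNIV. of_nat (n i) * \<alpha> i x) \<or>
          \<beta> = (\<lambda>x. - (\<Sum>i\<in>UNIV. of_nat (n i) * \<alpha> i x)))"

text \<open>The form on the dual of \<open>h\<close> that is transported from the Killing form.\<close>

definition dual_vector :: "'g set \<Rightarrow> ('g \<Rightarrow> complex) \<Rightarrow> 'g" where
  "dual_vector h \<mu> = (THE t. t \<in> h \<and> (\<forall>H\<in>h. killing_form t H = \<mu> H))"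

definition dual_form :: "'g set \<Rightarrow> ('g \<Rightarrow> complex) \<Rightarrow> ('g \<Rightarrow> complex) \<Rightarrow> complex" where
  "dual_form h \<mu> \<nu> = killing_form (dual_vector h \<mu>) (dual_vector h \<nu>)"

end

locale semisimple_lie_algebra = complex_lie_algebra scale bracket
  for scale :: "complex \<Rightarrow> 'g::ab_group_add \<Rightarrow> 'g" and bracket :: "'g \<Rightarrow> 'g \<Rightarrow> 'g" +
  fixes h :: "'g set" and \<alpha> :: "'i::finite \<Rightarrow> 'g \<Rightarrow> complex"
  assumes semisimple: semisimple
    and cartan_subalgebra: "cartan_subalgebra h"
    and simple_roots: "simple_roots h \<alpha>"
begin

definition fundamental_coord :: "('g \<Rightarrow> complex) \<Rightarrow> 'i \<Rightarrow> complex" where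
  "fundamental_coord \<mu> i = 2 * dual_form h \<mu> (\<alpha> i) / dual_form h (\<alpha> i) (\<alpha> i)"

text \<open>The fundamental weights \<open>\<varpi>\<^sub>i\<close> are the basis of the dual of \<open>h\<close> whose coordinate
  functions are \<open>\<lambda>\<mu>. fundamental_coord \<mu> i\<close>, so a functional is an integral
  (dominant integral) weight if and only if its coordinates are integers (natural numbers).\<close>

definition weight_lattice :: "('g \<Rightarrow> complex) set" where
  "weight_lattice = {\<mu> \<in> dual_space h. \<forall>i. fundamental_coord \<mu> i \<in> \<int>}"

definition dominant_weights :: "('g \<Rightarrow> complex) set" where
  "dominant_weights = {\<mu> \<in> weight_lattice. \<forall>i. fundamental_coord \<mu> i \<in> \<nat>}"

definition integral_coord :: "('g \<Rightarrow> complex) \<Rightarrow> 'i \<Rightarrow> int" where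
  "integral_coord \<mu> i = \<lfloor>Re (fundamental_coord \<mu> i)\<rfloor>"

definition cartan_matrix :: "'i \<Rightarrow> 'i \<Rightarrow> int" where
  "cartan_matrix i j = integral_coord (\<alpha> j) i"

text \<open>\<open>weight_pairing d \<mu> j\<close> is \<open>\<langle>\<mu>, \<alpha>\<^sub>j\<rangle>\<close> for the bilinear pairing with
  \<open>\<langle>\<varpi>\<^sub>i, \<alpha>\<^sub>j\<rangle> = \<delta>\<^sub>i\<^sub>j d\<^sub>j\<close>. The condition \<open>symmetrizer d\<close> says that \<open>d\<close> is positive
  and this pairing is symmetric; equivalently, on each simple component
  the pairing is a positive rescaling of the form induced by the Killing form, and
  \<open>2 d\<^sub>j = \<langle>\<alpha>\<^sub>j, \<alpha>\<^sub>j\<rangle>\<close>.\<close>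

definition weight_pairing :: "('i \<Rightarrow> nat) \<Rightarrow> ('g \<Rightarrow> complex) \<Rightarrow> 'i \<Rightarrow> int" where
  "weight_pairing d \<mu> j = int (d j) * integral_coord \<mu> j"

definition symmetrizer :: "('i \<Rightarrow> nat) \<Rightarrow> bool" where
  "symmetrizer d \<longleftrightarrow> (\<forall>i. d i > 0) \<and>
     (\<forall>i j. weight_pairing d (\<alpha> i) j = weight_pairing d (\<alpha> j) i)"

end

section \<open>Algebras given by generators and relations\<close>

datatype 'x free_monoid = Word (letters: "'x list")

instantiation free_monoid :: (type) monoid_add
begin

definition "0 = Word []"
definition "u + v = Word (letters u @ letters v)"

instance
  by intro_classes (simp_all add: zero_free_monoid_def plus_free_monoid_def)

end

text \<open>The free associative unital algebra on \<open>'x\<close> is the monoid algebra of the free monoid,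
  with the ring structure from the library (convolution).\<close>

type_synonym ('k, 'x) free_algebra = "'x free_monoid \<Rightarrow>\<^sub>0 'k"

definition free_gen :: "'x \<Rightarrow> ('k::field, 'x) free_algebra" where
  "free_gen x = Poly_Mapping.single (Word [x]) 1"

definition free_const :: "'k \<Rightarrow> ('k::field, 'x) free_algebra" where
  "free_const c = Poly_Mapping.single 0 c"

definition algebra_over :: "('k::field \<Rightarrow> 'u::ring_1 \<Rightarrow> 'u) \<Rightarrow> bool" where
  "algebra_over sm \<longleftrightarrow> vector_space sm \<and>
     (\<forall>c a b. sm c a * b = sm c (a * b) \<and> a * sm c b = sm c (a * b))"

definition free_eval ::
    "('k::field \<Rightarrow> 'u::ring_1 \<Rightarrow> 'u) \<Rightarrow> ('x \<Rightarrow> 'u) \<Rightarrow> ('k, 'x) free_algebra \<Rightarrow> 'u" where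
  "free_eval sm g p =
     (\<Sum>w\<in>Poly_Mapping.keys p. sm (Poly_Mapping.lookup p w) (prod_list (map g (letters w))))"

inductive_set two_sided_ideal :: "'a::ring_1 set \<Rightarrow> 'a set" for R :: "'a set" where
  zero: "0 \<in> two_sided_ideal R"
| add: "x \<in> two_sided_ideal R \<Longrightarrow> y \<in> two_sided_ideal R \<Longrightarrow> x + y \<in> two_sided_ideal R"
| mult: "r \<in> R \<Longrightarrow> x * r * y \<in> two_sided_ideal R"

definition presented_by ::
    "('k::field \<Rightarrow> 'u::ring_1 \<Rightarrow> 'u) \<Rightarrow> ('x \<Rightarrow> 'u) \<Rightarrow> ('k, 'x) free_algebra set \<Rightarrow> bool" where
  "presented_by sm g R \<longleftrightarrow> range (free_eval sm g) = UNIV \<and>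
     (\<forall>p. free_eval sm g p = 0 \<longleftrightarrow> p \<in> two_sided_ideal R)"

section \<open>Hopf algebras\<close>

text \<open>An element of the tensor power \<open>U \<otimes> \<dots> \<otimes> U\<close> is represented by a finite formal sum of
  pure tensors: the list \<open>[[x\<^sub>1, y\<^sub>1], [x\<^sub>2, y\<^sub>2], \<dots>]\<close> stands for
  \<open>x\<^sub>1 \<otimes> y\<^sub>1 + x\<^sub>2 \<otimes> y\<^sub>2 + \<dots>\<close>, and similarly with more factors. Two sums represent the same
  element if and only if they are related by the congruence \<open>tensor_eq\<close>.\<close>

inductive tensor_eq :: "('k \<Rightarrow> 'u::ab_group_add \<Rightarrow> 'u) \<Rightarrow> 'u list list \<Rightarrow> 'u list list \<Rightarrow> bool"
  for sm :: "'k \<Rightarrow> 'u \<Rightarrow> 'u" where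
  refl: "tensor_eq sm s s"
| sym: "tensor_eq sm s t \<Longrightarrow> tensor_eq sm t s"
| trans: "tensor_eq sm s t \<Longrightarrow> tensor_eq sm t u \<Longrightarrow> tensor_eq sm s u"
| append: "tensor_eq sm s s' \<Longrightarrow> tensor_eq sm t t' \<Longrightarrow> tensor_eq sm (s @ t) (s' @ t')"
| comm: "tensor_eq sm (s @ t) (t @ s)"
| zero: "tensor_eq sm [xs @ [0] @ ys] []"
| add: "tensor_eq sm [xs @ [a + b] @ ys] [xs @ [a] @ ys, xs @ [b] @ ys]"
| scale: "tensor_eq sm [xs @ [sm c a] @ ys @ [b] @ zs] [xs @ [a] @ ys @ [sm c b] @ zs]"

record ('k, 'u) hopf =
  smult :: "'k \<Rightarrow> 'u \<Rightarrow> 'u"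
  comult :: "'u \<Rightarrow> ('u \<times> 'u) list"
  counit :: "'u \<Rightarrow> 'k"
  antipode :: "'u \<Rightarrow> 'u"

definition tensors :: "('u \<times> 'u) list \<Rightarrow> 'u list list" where
  "tensors t = [[x, y]. (x, y) \<leftarrow> t]"

text \<open>\<^term>\<open>comult U a\<close> is a choice of representative of the coproduct of \<open>a\<close>, that is, a
  choice of summands in Sweedler's notation; all identities hold modulo \<open>tensor_eq\<close>.\<close>

definition hopf_algebra :: "('k::field, 'u::ring_1) hopf \<Rightarrow> bool" where
  "hopf_algebra U \<longleftrightarrow>
     (let sm = smult U; \<Delta> = comult U; \<epsilon> = counit U; \<sigma> = antipode U in
      algebra_over sm
      \<and> (\<forall>a b. tensor_eq sm (tensors (\<Delta> (a + b))) (tensors (\<Delta> a @ \<Delta> b)))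
      \<and> (\<forall>c a. tensor_eq sm (tensors (\<Delta> (sm c a))) [[sm c x, y]. (x, y) \<leftarrow> \<Delta> a])
      \<and> tensor_eq sm (tensors (\<Delta> 1)) [[1, 1]]
      \<and> (\<forall>a b. tensor_eq sm (tensors (\<Delta> (a * b)))
            [[x * x', y * y']. (x, y) \<leftarrow> \<Delta> a, (x', y') \<leftarrow> \<Delta> b])
      \<and> (\<forall>a b. \<epsilon> (a + b) = \<epsilon> a + \<epsilon> b) \<and> (\<forall>c a. \<epsilon> (sm c a) = c * \<epsilon> a)
      \<and> \<epsilon> 1 = 1 \<and> (\<forall>a b. \<epsilon> (a * b) = \<epsilon> a * \<epsilon> b)
      \<and> (\<forall>a. tensor_eq sm
            [[x\<^sub>1, x\<^sub>2, y]. (x, y) \<leftarrow> \<Delta> a, (x\<^sub>1, x\<^sub>2) \<leftarrow> \<Delta> x]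
            [[x, y\<^sub>1, y\<^sub>2]. (x, y) \<leftarrow> \<Delta> a, (y\<^sub>1, y\<^sub>2) \<leftarrow> \<Delta> y])
      \<and> (\<forall>a. (\<Sum>(x, y)\<leftarrow>\<Delta> a. sm (\<epsilon> x) y) = a \<and> (\<Sum>(x, y)\<leftarrow>\<Delta> a. sm (\<epsilon> y) x) = a)
      \<and> (\<forall>a b. \<sigma> (a + b) = \<sigma> a + \<sigma> b) \<and> (\<forall>c a. \<sigma> (sm c a) = sm c (\<sigma> a))
      \<and> (\<forall>a. (\<Sum>(x, y)\<leftarrow>\<Delta> a. \<sigma> x * y) = sm (\<epsilon> a) 1
            \<and> (\<Sum>(x, y)\<leftarrow>\<Delta> a. x * \<sigma> y) = sm (\<epsilon> a) 1))"

definition hopf_subalgebra :: "('k::field, 'u::ring_1) hopf \<Rightarrow> 'u set \<Rightarrow> bool" where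
  "hopf_subalgebra U A \<longleftrightarrow> module.subspace (smult U) A \<and> 1 \<in> A
     \<and> (\<forall>a\<in>A. \<forall>b\<in>A. a * b \<in> A) \<and> (\<forall>a\<in>A. antipode U a \<in> A)
     \<and> (\<forall>a\<in>A. \<exists>t. set t \<subseteq> A \<times> A \<and> tensor_eq (smult U) (tensors (comult U a)) (tensors t))"

definition hopf_generated :: "('k::field, 'u::ring_1) hopf \<Rightarrow> 'u set \<Rightarrow> 'u set" where
  "hopf_generated U X = \<Inter>{A. hopf_subalgebra U A \<and> X \<subseteq> A}"

definition ad_L :: "('k, 'u::ring_1) hopf \<Rightarrow> 'u \<Rightarrow> 'u \<Rightarrow> 'u" where
  "ad_L U a b = (\<Sum>(x, y)\<leftarrow>comult U a. x * b * antipode U y)"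

section \<open>The quantized enveloping algebra\<close>

datatype 'i uq_gen = E 'i | F 'i | K 'i | Kinv 'i

definition qint :: "'k::field \<Rightarrow> nat \<Rightarrow> 'k" where
  "qint q n = (q powi int n - q powi (- int n)) / (q - inverse q)"

definition qfact :: "'k::field \<Rightarrow> nat \<Rightarrow> 'k" where
  "qfact q n = (\<Prod>k=1..n. qint q k)"

definition qbinomial :: "'k::field \<Rightarrow> nat \<Rightarrow> nat \<Rightarrow> 'k" where
  "qbinomial q n k = qfact q n / (qfact q k * qfact q (n - k))"

definition serre_element ::
    "'k::field \<Rightarrow> nat \<Rightarrow> ('k, 'x) free_algebra \<Rightarrow> ('k, 'x) free_algebra \<Rightarrow> ('k, 'x) free_algebra" where
  "serre_element q n x y =
     (\<Sum>s\<le>n. free_const ((- 1) ^ s * qbinomial q n s) * x ^ (n - s) * y * x ^ s)"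

text \<open>Here \<open>A\<close> is the Cartan matrix and \<open>d\<close> a symmetrizer, so \<open>\<langle>\<alpha>\<^sub>i, \<alpha>\<^sub>j\<rangle> = d\<^sub>i a\<^sub>i\<^sub>j\<close> and
  \<open>q\<^sub>i = q ^ d\<^sub>i\<close>.\<close>

definition uq_relators ::
    "('i \<Rightarrow> 'i \<Rightarrow> int) \<Rightarrow> ('i \<Rightarrow> nat) \<Rightarrow> 'k::field \<Rightarrow> ('k, 'i uq_gen) free_algebra set" where
  "uq_relators A d q =
     (let e = (\<lambda>i. free_gen (E i)); f = (\<lambda>i. free_gen (F i));
          k = (\<lambda>i. free_gen (K i)); k' = (\<lambda>i. free_gen (Kinv i)) in
      {k i * k' i - 1 | i. True} \<union> {k' i * k i - 1 | i. True}
      \<union> {k i * k j - k j * k i | i j. True}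
      \<union> {k i * e j * k' i - free_const (q powi (int (d i) * A i j)) * e j | i j. True}
      \<union> {k i * f j * k' i - free_const (q powi (- (int (d i) * A i j))) * f j | i j. True}
      \<union> {e i * f i - f i * e i
           - free_const (1 / (q ^ d i - inverse (q ^ d i))) * (k i - k' i) | i. True}
      \<union> {e i * f j - f j * e i | i j. i \<noteq> j}
      \<union> {serre_element (q ^ d i) (nat (1 - A i j)) (e i) (e j) | i j. i \<noteq> j}
      \<union> {serre_element (q ^ d i) (nat (1 - A i j)) (f i) (f j) | i j. i \<noteq> j})"

definition quantized_enveloping_algebra ::
    "('i \<Rightarrow> 'i \<Rightarrow> int) \<Rightarrow> ('i \<Rightarrow> nat) \<Rightarrow> 'k::field \<Rightarrow>
     ('k, 'u::ring_1) hopf \<Rightarrow> ('i uq_gen \<Rightarrow> 'u) \<Rightarrow> bool" where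
  "quantized_enveloping_algebra A d q U g \<longleftrightarrow>
     hopf_algebra U \<and> presented_by (smult U) g (uq_relators A d q)
     \<and> (\<forall>i. tensor_eq (smult U) (tensors (comult U (g (E i)))) [[g (E i), 1], [g (K i), g (E i)]])
     \<and> (\<forall>i. tensor_eq (smult U) (tensors (comult U (g (F i)))) [[g (F i), g (Kinv i)], [1, g (F i)]])
     \<and> (\<forall>i. tensor_eq (smult U) (tensors (comult U (g (K i)))) [[g (K i), g (K i)]])"

definition quantum_levi ::
    "('k::field, 'u::ring_1) hopf \<Rightarrow> ('i uq_gen \<Rightarrow> 'u) \<Rightarrow> 'i set \<Rightarrow> 'u set" where
  "quantum_levi U g S =
     hopf_generated U (g ` (E ` S \<union> F ` S \<union> range K \<union> range Kinv))"

section \<open>Modules\<close>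

text \<open>A left module consists of a vector space structure and an action of elements of \<open>U\<close>; the
  predicates take the acting subalgebra \<open>L\<close> and the carrier \<open>M\<close>. Only the action of \<open>L\<close> matters.\<close>

record ('k, 'u, 'v) lmodule =
  vscale :: "'k \<Rightarrow> 'v \<Rightarrow> 'v"
  action :: "'u \<Rightarrow> 'v \<Rightarrow> 'v"

definition submodule ::
    "'u set \<Rightarrow> ('k::field, 'u, 'v::ab_group_add) lmodule \<Rightarrow> 'v set \<Rightarrow> bool" where
  "submodule L V N \<longleftrightarrow> module.subspace (vscale V) N \<and> (\<forall>a\<in>L. \<forall>v\<in>N. action V a v \<in> N)"

definition left_module ::
    "('k::field, 'u::ring_1) hopf \<Rightarrow> 'u set \<Rightarrow> ('k, 'u, 'v::ab_group_add) lmodule \<Rightarrow> bool" where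
  "left_module U L V \<longleftrightarrow> vector_space (vscale V)
     \<and> (\<forall>a\<in>L. \<forall>v w. action V a (v + w) = action V a v + action V a w)
     \<and> (\<forall>a\<in>L. \<forall>c v. action V a (vscale V c v) = vscale V c (action V a v))
     \<and> (\<forall>a\<in>L. \<forall>b\<in>L. \<forall>v. action V (a + b) v = action V a v + action V b v)
     \<and> (\<forall>a\<in>L. \<forall>c v. action V (smult U c a) v = vscale V c (action V a v))
     \<and> (\<forall>a\<in>L. \<forall>b\<in>L. \<forall>v. action V (a * b) v = action V a (action V b v))
     \<and> (\<forall>v. action V 1 v = v)"

definition module_iso ::
    "'u set \<Rightarrow> ('k::field, 'u, 'v::ab_group_add) lmodule \<Rightarrow> 'v set \<Rightarrow>
     ('k, 'u, 'w::ab_group_add) lmodule \<Rightarrow> 'w set \<Rightarrow> bool" where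
  "module_iso L V M W N \<longleftrightarrow> (\<exists>\<phi>. bij_betw \<phi> M N
     \<and> (\<forall>v\<in>M. \<forall>w\<in>M. \<phi> (v + w) = \<phi> v + \<phi> w)
     \<and> (\<forall>c. \<forall>v\<in>M. \<phi> (vscale V c v) = vscale W c (\<phi> v))
     \<and> (\<forall>a\<in>L. \<forall>v\<in>M. \<phi> (action V a v) = action W a (\<phi> v)))"

definition finite_dimensional :: "('k::field \<Rightarrow> 'v::ab_group_add \<Rightarrow> 'v) \<Rightarrow> 'v set \<Rightarrow> bool" where
  "finite_dimensional sm M \<longleftrightarrow> (\<exists>B. finite B \<and> M \<subseteq> module.span sm B)"

definition irreducible_module ::
    "'u set \<Rightarrow> ('k::field, 'u, 'v::ab_group_add) lmodule \<Rightarrow> bool" where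
  "irreducible_module L V \<longleftrightarrow> (UNIV :: 'v set) \<noteq> {0}
     \<and> (\<forall>N. submodule L V N \<longrightarrow> N = {0} \<or> N = UNIV)"

text \<open>\<open>n j\<close> is the integer \<open>\<langle>\<lambda>, \<alpha>\<^sub>j\<rangle>\<close> for the highest weight \<open>\<lambda>\<close>. An irreducible module is
  generated by any nonzero vector, hence by the highest weight vector.\<close>

definition has_highest_weight ::
    "'k::field \<Rightarrow> ('i uq_gen \<Rightarrow> 'u) \<Rightarrow> 'i set \<Rightarrow> ('i \<Rightarrow> int) \<Rightarrow>
     ('k, 'u, 'v::ab_group_add) lmodule \<Rightarrow> bool" where
  "has_highest_weight q g S n V \<longleftrightarrow> (\<exists>v. v \<noteq> 0
     \<and> (\<forall>i\<in>S. action V (g (E i)) v = 0)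
     \<and> (\<forall>j. action V (g (K j)) v = vscale V (q powi n j) v))"

definition is_irreducible_highest_weight_module ::
    "'k::field \<Rightarrow> ('k, 'u::ring_1) hopf \<Rightarrow> ('i uq_gen \<Rightarrow> 'u) \<Rightarrow> 'i set \<Rightarrow> ('i \<Rightarrow> int) \<Rightarrow>
     ('k, 'u, 'v::ab_group_add) lmodule \<Rightarrow> bool" where
  "is_irreducible_highest_weight_module q U g S n V \<longleftrightarrow>
     left_module U (quantum_levi U g S) V
     \<and> finite_dimensional (vscale V) UNIV
     \<and> irreducible_module (quantum_levi U g S) V
     \<and> has_highest_weight q g S n V"

section \<open>The adjoint module, its relative locally finite part, and embeddings\<close>

definition adjoint_module :: "('k, 'u::ring_1) hopf \<Rightarrow> ('k, 'u, 'u) lmodule" where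
  "adjoint_module U = \<lparr>vscale = smult U, action = ad_L U\<rparr>"

definition cyclic_adjoint_module ::
    "('k::field, 'u::ring_1) hopf \<Rightarrow> ('i uq_gen \<Rightarrow> 'u) \<Rightarrow> 'i set \<Rightarrow> 'u \<Rightarrow> 'u set" where
  "cyclic_adjoint_module U g S v = {ad_L U a v | a. a \<in> quantum_levi U g S}"

definition locally_finite_part ::
    "('k::field, 'u::ring_1) hopf \<Rightarrow> ('i uq_gen \<Rightarrow> 'u) \<Rightarrow> 'i set \<Rightarrow> 'u set" where
  "locally_finite_part U g S =
     {v. finite_dimensional (smult U) (cyclic_adjoint_module U g S v)}"

definition locally_finite_part_of_type ::
    "('k::field, 'u::ring_1) hopf \<Rightarrow> ('i uq_gen \<Rightarrow> 'u) \<Rightarrow> 'i set \<Rightarrow>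
     ('k, 'u, 'v::ab_group_add) lmodule \<Rightarrow> 'u set" where
  "locally_finite_part_of_type U g S V =
     {v \<in> locally_finite_part U g S.
        module_iso (quantum_levi U g S) (adjoint_module U) (cyclic_adjoint_module U g S v) V UNIV}"

definition embeddings_of_type ::
    "('k::field, 'u::ring_1) hopf \<Rightarrow> ('i uq_gen \<Rightarrow> 'u) \<Rightarrow> 'i set \<Rightarrow>
     ('k, 'u, 'v::ab_group_add) lmodule \<Rightarrow> 'u set set" where
  "embeddings_of_type U g S V =
     {M. submodule (quantum_levi U g S) (adjoint_module U) M
       \<and> module_iso (quantum_levi U g S) (adjoint_module U) M V UNIV}"

end

(* The only point that is not formal is that M(v) is a submodule, i.e. that ad_L is an action.
   This rests on antimultiplicativity of the antipode, which is obtained by evaluating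
   \<sigma>(a1 b1) a2 b2 \<sigma>(b3) \<sigma>(a3) in two ways. Conversely, a submodule isomorphic
   to V is generated by any of its nonzero vectors, because V is irreducible. *)
theory Submission
  imports Defs
begin

section \<open>Evaluating multilinear maps on formal tensors\<close>

text \<open>This is the universal property of the tensor power in the form used here. By rule
  induction only the rules \<open>zero\<close>, \<open>add\<close> and \<open>scale\<close>
  constrain \<open>f\<close>; the others are respected by any sum in an abelian group.\<close>

lemma tensor_eq_sum_list:
  fixes f :: "'u::ab_group_add list \<Rightarrow> 'w::ab_group_add"
  assumes "tensor_eq sm s t"
    and zero: "\<And>xs ys. f (xs @ [0] @ ys) = 0"
    and add: "\<And>xs a b ys. f (xs @ [a + b] @ ys) = f (xs @ [a] @ ys) + f (xs @ [b] @ ys)"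
    and scale: "\<And>xs c a ys b zs.
      f (xs @ [sm c a] @ ys @ [b] @ zs) = f (xs @ [a] @ ys @ [sm c b] @ zs)"
  shows "sum_list (map f s) = sum_list (map f t)"
  using assms(1)
proof induction
  case (zero xs ys)
  show ?case using assms(2)[of xs ys] by simp
next
  case (add xs a b ys)
  show ?case using assms(3)[of xs a b ys] by simp
next
  case (scale xs c a ys b zs)
  show ?case using assms(4)[of xs c a ys b zs] by simp
qed (auto simp: add.commute)

text \<open>The target is only an abelian group, so bilinearity is replaced by biadditivity and the
  passing of scalars from one slot to the other.\<close>

definition balanced2 :: "('k \<Rightarrow> 'u \<Rightarrow> 'u) \<Rightarrow> ('u::ab_group_add \<Rightarrow> 'u \<Rightarrow> 'w::ab_group_add) \<Rightarrow> bool"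
  where "balanced2 sm B \<longleftrightarrow>
    (\<forall>x x' y. B (x + x') y = B x y + B x' y) \<and>
    (\<forall>x y y'. B x (y + y') = B x y + B x y') \<and>
    (\<forall>c x y. B (sm c x) y = B x (sm c y))"

text \<open>Scalars move only between neighbouring slots; composing the two moves gives the exchange
  of the outer slots, which the rule \<open>scale\<close> also allows.\<close>

definition balanced3 ::
  "('k \<Rightarrow> 'u \<Rightarrow> 'u) \<Rightarrow> ('u::ab_group_add \<Rightarrow> 'u \<Rightarrow> 'u \<Rightarrow> 'w::ab_group_add) \<Rightarrow> bool"
  where "balanced3 sm T \<longleftrightarrow>
    (\<forall>x x' y z. T (x + x') y z = T x y z + T x' y z) \<and>
    (\<forall>x y y' z. T x (y + y') z = T x y z + T x y' z) \<and>
    (\<forall>x y z z'. T x y (z + z') = T x y z + T x y z') \<and>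
    (\<forall>c x y z. T (sm c x) y z = T x (sm c y) z) \<and>
    (\<forall>c x y z. T x (sm c y) z = T x y (sm c z))"

lemma additive_zero:
  fixes f :: "'a::ab_group_add \<Rightarrow> 'b::ab_group_add"
  assumes "\<And>x y. f (x + y) = f x + f y"
  shows "f 0 = 0"
  using assms[of 0 0] by simp

text \<open>Formal tensors may mix lengths, so the maps are extended by zero to the other lengths.\<close>

lemma tensor_eq_balanced2:
  assumes "tensor_eq sm s t" and "balanced2 sm B"
  shows "sum_list (map (\<lambda>l. case l of [x, y] \<Rightarrow> B x y | _ \<Rightarrow> 0) s) =
         sum_list (map (\<lambda>l. case l of [x, y] \<Rightarrow> B x y | _ \<Rightarrow> 0) t)"
proof (rule tensor_eq_sum_list[OF assms(1)])
  have [simp]: "B (x + x') y = B x y + B x' y" "B x (y + y') = B x y + B x y'"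
      "B (sm c x) y = B x (sm c y)" for c x x' y y'
    using assms(2) by (auto simp: balanced2_def)
  have [simp]: "B 0 y = 0" "B x 0 = 0" for x y
    by (rule additive_zero[of "\<lambda>x. B x y"], simp) (rule additive_zero[of "B x"], simp)
  fix xs ys zs a b c
  show "(case xs @ [0] @ ys of [x, y] \<Rightarrow> B x y | _ \<Rightarrow> 0) = 0"
    by (auto simp: append_eq_Cons_conv split: list.splits)
  \<comment> \<open>Only the position of the changed slot and the total length matter; at any length
    other than 2 both sides are 0.\<close>
  show "(case xs @ [a + b] @ ys of [x, y] \<Rightarrow> B x y | _ \<Rightarrow> 0) =
      (case xs @ [a] @ ys of [x, y] \<Rightarrow> B x y | _ \<Rightarrow> 0) +
      (case xs @ [b] @ ys of [x, y] \<Rightarrow> B x y | _ \<Rightarrow> 0)"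
    by (cases xs; cases "tl xs") (auto split: list.splits)
  show "(case xs @ [sm c a] @ ys @ [b] @ zs of [x, y] \<Rightarrow> B x y | _ \<Rightarrow> 0) =
      (case xs @ [a] @ ys @ [sm c b] @ zs of [x, y] \<Rightarrow> B x y | _ \<Rightarrow> 0)"
    by (cases xs; cases ys) (auto split: list.splits)
qed

lemma tensor_eq_balanced3:
  assumes "tensor_eq sm s t" and "balanced3 sm T"
  shows "sum_list (map (\<lambda>l. case l of [x, y, z] \<Rightarrow> T x y z | _ \<Rightarrow> 0) s) =
         sum_list (map (\<lambda>l. case l of [x, y, z] \<Rightarrow> T x y z | _ \<Rightarrow> 0) t)"
proof (rule tensor_eq_sum_list[OF assms(1)])
  \<comment> \<open>The scalar rules are oriented so that every scalar ends up in the last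
    slot.\<close>
  have [simp]: "T (x + x') y z = T x y z + T x' y z" "T x (y + y') z = T x y z + T x y' z"
      "T x y (z + z') = T x y z + T x y z'"
      "T (sm c x) y z = T x y (sm c z)" "T x (sm c y) z = T x y (sm c z)" for c x x' y y' z z'
    using assms(2) by (auto simp: balanced3_def)
  have [simp]: "T 0 y z = 0" "T x 0 z = 0" "T x y 0 = 0" for x y z
    by (rule additive_zero[of "\<lambda>x. T x y z"], simp)
       (rule additive_zero[of "\<lambda>y. T x y z"], simp, rule additive_zero[of "T x y"], simp)
  fix xs ys zs a b c
  show "(case xs @ [0] @ ys of [x, y, z] \<Rightarrow> T x y z | _ \<Rightarrow> 0) = 0"
    by (auto simp: append_eq_Cons_conv split: list.splits)
  show "(case xs @ [a + b] @ ys of [x, y, z] \<Rightarrow> T x y z | _ \<Rightarrow> 0) =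
      (case xs @ [a] @ ys of [x, y, z] \<Rightarrow> T x y z | _ \<Rightarrow> 0) +
      (case xs @ [b] @ ys of [x, y, z] \<Rightarrow> T x y z | _ \<Rightarrow> 0)"
    by (cases xs; cases "tl xs"; cases "tl (tl xs)") (auto split: list.splits)
  show "(case xs @ [sm c a] @ ys @ [b] @ zs of [x, y, z] \<Rightarrow> T x y z | _ \<Rightarrow> 0) =
      (case xs @ [a] @ ys @ [sm c b] @ zs of [x, y, z] \<Rightarrow> T x y z | _ \<Rightarrow> 0)"
    by (cases xs; cases "tl xs"; cases ys; cases "tl ys") (auto split: list.splits)
qed

section \<open>Sweedler sums\<close>

text \<open>The value refers to the chosen representative \<open>comult U a\<close>. It is intrinsic
  when \<open>f\<close> is balanced, so identities that rewrite the coproduct carry a balancedness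
  hypothesis, while those that only manipulate summands do not.\<close>

definition sweedler :: "('k, 'u) hopf \<Rightarrow> 'u \<Rightarrow> ('u \<Rightarrow> 'u \<Rightarrow> 'w::ab_group_add) \<Rightarrow> 'w" where
  "sweedler U a f = (\<Sum>(x, y)\<leftarrow>comult U a. f x y)"

lemma sum_list_additive:
  fixes f :: "'b::ab_group_add \<Rightarrow> 'w::ab_group_add"
  assumes "\<And>x y. f (x + y) = f x + f y"
  shows "f (\<Sum>x\<leftarrow>xs. h x) = (\<Sum>x\<leftarrow>xs. f (h x))"
  by (induction xs) (auto simp: assms additive_zero[of f, OF assms])

lemma sweedler_additive:
  assumes "\<And>x y. f (x + y) = f x + f y"
  shows "f (sweedler U a h) = sweedler U a (\<lambda>x y. f (h x y))"
  unfolding sweedler_def by (subst sum_list_additive[of f, OF assms]) (simp_all add: case_prod_unfold)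

lemma sweedler_add:
  "sweedler U a (\<lambda>x y. f x y + h x y) = sweedler U a f + sweedler U a h"
  by (simp add: sweedler_def case_prod_unfold sum_list_addf)

lemma sweedler_mult_left:
  fixes h :: "'u \<Rightarrow> 'u \<Rightarrow> 'w::ring"
  shows "c * sweedler U a h = sweedler U a (\<lambda>x y. c * h x y)"
  by (rule sweedler_additive) (rule distrib_left)

lemma sweedler_mult_right:
  fixes h :: "'u \<Rightarrow> 'u \<Rightarrow> 'w::ring"
  shows "sweedler U a h * c = sweedler U a (\<lambda>x y. h x y * c)"
  by (rule sweedler_additive[of "\<lambda>z. z * c"]) (rule distrib_right)

lemma sum_list_swap:
  fixes f :: "'a \<Rightarrow> 'b \<Rightarrow> 'w::ab_group_add"
  shows "(\<Sum>x\<leftarrow>xs. \<Sum>y\<leftarrow>ys. f x y) = (\<Sum>y\<leftarrow>ys. \<Sum>x\<leftarrow>xs. f x y)"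
  by (induction xs) (auto simp: sum_list_addf)

lemma sweedler_swap:
  "sweedler U a (\<lambda>x y. sweedler U b (f x y)) =
   sweedler U b (\<lambda>x' y'. sweedler U a (\<lambda>x y. f x y x' y'))"
  unfolding sweedler_def case_prod_unfold by (rule sum_list_swap)

lemma sum_list_map_concat:
  fixes f :: "'a \<Rightarrow> 'w::monoid_add"
  shows "sum_list (map f (concat xss)) = (\<Sum>xs\<leftarrow>xss. sum_list (map f xs))"
  by (induction xss) auto

section \<open>The antipode and the adjoint action\<close>

locale hopf =
  fixes U :: "('k::field, 'u::ring_1) hopf"
  assumes hopf_algebra: "hopf_algebra U"
begin

abbreviation sm where "sm \<equiv> smult U"
abbreviation eps ("\<epsilon>") where "\<epsilon> \<equiv> counit U"
abbreviation antip ("\<sigma>") where "\<sigma> \<equiv> antipode U"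

section \<open>The Hopf algebra axioms as identities between Sweedler sums\<close>

lemma algebra_over: "algebra_over sm"
  using hopf_algebra unfolding hopf_algebra_def Let_def by blast

sublocale vector_space sm
  using algebra_over unfolding algebra_over_def by blast

lemma smult_mult [simp]: "sm c a * b = sm c (a * b)" "a * sm c b = sm c (a * b)"
  using algebra_over unfolding algebra_over_def by blast+

lemma antipode_add [simp]: "\<sigma> (a + b) = \<sigma> a + \<sigma> b"
  using hopf_algebra unfolding hopf_algebra_def Let_def by blast

lemma antipode_smult [simp]: "\<sigma> (sm c a) = sm c (\<sigma> a)"
  using hopf_algebra unfolding hopf_algebra_def Let_def by blast

lemma counit_mult [simp]: "\<epsilon> (a * b) = \<epsilon> a * \<epsilon> b"
  using hopf_algebra unfolding hopf_algebra_def Let_def by blast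

lemma sweedler_smult: "sm c (sweedler U a h) = sweedler U a (\<lambda>x y. sm c (h x y))"
  by (rule sweedler_additive) (rule scale_right_distrib)

lemma sweedler_counit:
  "sweedler U a (\<lambda>x y. sm (\<epsilon> x) y) = a" "sweedler U a (\<lambda>x y. sm (\<epsilon> y) x) = a"
  using hopf_algebra unfolding hopf_algebra_def Let_def sweedler_def by blast+

lemma sweedler_antipode:
  "sweedler U a (\<lambda>x y. \<sigma> x * y) = sm (\<epsilon> a) 1" "sweedler U a (\<lambda>x y. x * \<sigma> y) = sm (\<epsilon> a) 1"
  using hopf_algebra unfolding hopf_algebra_def Let_def sweedler_def by blast+

text \<open>The axiom for the coproduct of a sum holds only modulo \<open>tensor_eq\<close>;
  evaluating a balanced map on both representatives turns it into an equation. The next three lemmas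
  do the same for scalars, products and coassociativity.\<close>

lemma sweedler_of_add:
  assumes "balanced2 sm B"
  shows "sweedler U (a + b) B = sweedler U a B + sweedler U b B"
proof -
  have "tensor_eq sm (tensors (comult U (a + b))) (tensors (comult U a @ comult U b))"
    using hopf_algebra unfolding hopf_algebra_def Let_def by blast
  from tensor_eq_balanced2[OF this assms] show ?thesis
    by (simp add: sweedler_def tensors_def case_prod_unfold o_def)
qed

lemma sweedler_of_smult:
  assumes "balanced2 sm B"
  shows "sweedler U (sm c a) B = sweedler U a (\<lambda>x y. B (sm c x) y)"
proof -
  have "tensor_eq sm (tensors (comult U (sm c a))) [[sm c x, y]. (x, y) \<leftarrow> comult U a]"
    using hopf_algebra unfolding hopf_algebra_def Let_def by blast
  from tensor_eq_balanced2[OF this assms] show ?thesis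
    by (simp add: sweedler_def tensors_def case_prod_unfold o_def)
qed

lemma sweedler_of_mult:
  assumes "balanced2 sm B"
  shows "sweedler U (a * b) B =
    sweedler U a (\<lambda>x y. sweedler U b (\<lambda>x' y'. B (x * x') (y * y')))"
proof -
  have "tensor_eq sm (tensors (comult U (a * b)))
      [[x * x', y * y']. (x, y) \<leftarrow> comult U a, (x', y') \<leftarrow> comult U b]"
    using hopf_algebra unfolding hopf_algebra_def Let_def by blast
  from tensor_eq_balanced2[OF this assms] show ?thesis
    by (simp add: sweedler_def tensors_def case_prod_unfold o_def sum_list_map_concat)
qed

lemma sweedler_coassoc:
  assumes "balanced3 sm T"
  shows "sweedler U a (\<lambda>x y. sweedler U x (\<lambda>x1 x2. T x1 x2 y)) =
         sweedler U a (\<lambda>x y. sweedler U y (\<lambda>y1 y2. T x y1 y2))"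
proof -
  have "tensor_eq sm [[x1, x2, y]. (x, y) \<leftarrow> comult U a, (x1, x2) \<leftarrow> comult U x]
            [[x, y1, y2]. (x, y) \<leftarrow> comult U a, (y1, y2) \<leftarrow> comult U y]"
    using hopf_algebra unfolding hopf_algebra_def Let_def by blast
  from tensor_eq_balanced3[OF this assms] show ?thesis
    by (simp add: sweedler_def tensors_def case_prod_unfold o_def sum_list_map_concat)
qed

text \<open>With respect to convolution, \<open>\<sigma> (a * b)\<close> is a left inverse and
  \<open>\<sigma> b * \<sigma> a\<close> a right inverse of the multiplication map on pairs, so the
  two agree.\<close>

lemma antipode_mult: "\<sigma> (a * b) = \<sigma> b * \<sigma> a"
proof -
  \<comment> \<open>The legs of \<open>a\<close> are \<open>x\<close>, \<open>y1\<close>,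
    \<open>y2\<close> and those of \<open>b\<close> are \<open>x'\<close>, \<open>y1'\<close>,
    \<open>y2'\<close>. Both coproducts are iterated on the right, which suits the first evaluation
    directly; the second needs coassociativity.\<close>
  define Z where "Z = sweedler U a (\<lambda>x y. sweedler U y (\<lambda>y1 y2.
    sweedler U b (\<lambda>x' y'. sweedler U y' (\<lambda>y1' y2'.
      \<sigma> (x * x') * y1 * y1' * \<sigma> y2' * \<sigma> y2))))"
  \<comment> \<open>The adjacent legs \<open>y1' * \<sigma> y2'\<close> collapse to
    \<open>\<epsilon> y'\<close>, and the counit law then restores \<open>b\<close> from
    \<open>x'\<close>.\<close>
  have "sweedler U b (\<lambda>x' y'. sweedler U y' (\<lambda>y1' y2'.
      \<sigma> (x * x') * y1 * y1' * \<sigma> y2' * \<sigma> y2)) = \<sigma> (x * b) * y1 * \<sigma> y2" for x y1 y2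
  proof -
    have "sweedler U y' (\<lambda>y1' y2'. \<sigma> (x * x') * y1 * y1' * \<sigma> y2' * \<sigma> y2) =
        \<sigma> (x * sm (\<epsilon> y') x') * y1 * \<sigma> y2" for x' y'
    proof -
      have "sweedler U y' (\<lambda>y1' y2'. \<sigma> (x * x') * y1 * y1' * \<sigma> y2' * \<sigma> y2) =
          \<sigma> (x * x') * y1 * sweedler U y' (\<lambda>y1' y2'. y1' * \<sigma> y2') * \<sigma> y2"
        by (simp add: sweedler_mult_left sweedler_mult_right mult.assoc)
      then show ?thesis by (simp add: sweedler_antipode)
    qed
    then have "sweedler U b (\<lambda>x' y'. sweedler U y' (\<lambda>y1' y2'.
        \<sigma> (x * x') * y1 * y1' * \<sigma> y2' * \<sigma> y2)) =
        sweedler U b (\<lambda>x' y'. \<sigma> (x * sm (\<epsilon> y') x') * y1 * \<sigma> y2)"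
      by simp
    also have "\<dots> = \<sigma> (x * sweedler U b (\<lambda>x' y'. sm (\<epsilon> y') x')) * y1 * \<sigma> y2"
      by (rule sweedler_additive[symmetric, of "\<lambda>z. \<sigma> (x * z) * y1 * \<sigma> y2"])
        (simp add: algebra_simps)
    finally show ?thesis by (simp only: sweedler_counit)
  qed
  then have "Z = sweedler U a (\<lambda>x y. sweedler U y (\<lambda>y1 y2. \<sigma> (x * b) * y1 * \<sigma> y2))"
    by (simp add: Z_def)
  \<comment> \<open>With \<open>b\<close> used up, \<open>y1\<close> and \<open>\<sigma> y2\<close>
    have become adjacent, so the same collapse applies to \<open>a\<close>.\<close>
  also have "\<dots> = sweedler U a (\<lambda>x y. \<sigma> (x * b) * sweedler U y (\<lambda>y1 y2. y1 * \<sigma> y2))"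
    by (simp add: sweedler_mult_left mult.assoc)
  also have "\<dots> = sweedler U a (\<lambda>x y. \<sigma> (sm (\<epsilon> y) x * b))"
    by (simp add: sweedler_antipode)
  also have "\<dots> = \<sigma> (sweedler U a (\<lambda>x y. sm (\<epsilon> y) x) * b)"
    by (rule sweedler_additive[symmetric, of "\<lambda>z. \<sigma> (z * b)"]) (simp add: algebra_simps)
  finally have Z1: "Z = \<sigma> (a * b)" by (simp only: sweedler_counit)
  \<comment> \<open>For the second evaluation the first two legs must come from the left factor.
    Coassociativity applies because the whole inner sum over \<open>b\<close> is balanced in the
    three legs of \<open>a\<close>.\<close>
  have "Z = sweedler U a (\<lambda>x y. sweedler U x (\<lambda>x1 x2.
    sweedler U b (\<lambda>x' y'. sweedler U y' (\<lambda>y1' y2'.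
      \<sigma> (x1 * x') * x2 * y1' * \<sigma> y2' * \<sigma> y))))"
    unfolding Z_def
    by (rule sweedler_coassoc[symmetric])
      (simp add: balanced3_def algebra_simps sweedler_add)
  also have "\<dots> = sweedler U a (\<lambda>x y. sweedler U x (\<lambda>x1 x2.
    sweedler U b (\<lambda>x' y'. sweedler U x' (\<lambda>x1' x2'.
      \<sigma> (x1 * x1') * x2 * x2' * \<sigma> y' * \<sigma> y))))"
  proof -
    have "balanced3 sm (\<lambda>x' y1' y2'. \<sigma> (x1 * x') * x2 * y1' * \<sigma> y2' * \<sigma> y)" for x1 x2 y
      by (simp add: balanced3_def algebra_simps)
    from sweedler_coassoc[OF this] show ?thesis by simp
  qed
  \<comment> \<open>Splitting \<open>x\<close> and splitting \<open>b\<close> are independent and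
    may be exchanged. This brings the two inner splittings together and lets the antipodes of the
    outer legs factor out.\<close>
  also have "\<dots> = sweedler U a (\<lambda>x y. sweedler U b (\<lambda>x' y'. sweedler U x (\<lambda>x1 x2.
      sweedler U x' (\<lambda>x1' x2'. \<sigma> (x1 * x1') * (x2 * x2')))  * \<sigma> y' * \<sigma> y))"
    by (subst sweedler_swap) (simp add: sweedler_mult_right mult.assoc)
  \<comment> \<open>Since the coproduct is multiplicative, the inner double sum is one Sweedler sum
    over \<open>x * x'\<close>, to which the antipode axiom applies.\<close>
  also have "\<dots> = sweedler U a (\<lambda>x y. sweedler U b (\<lambda>x' y'.
      sweedler U (x * x') (\<lambda>u v. \<sigma> u * v) * \<sigma> y' * \<sigma> y))"
    by (subst sweedler_of_mult) (simp_all add: balanced2_def algebra_simps)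
  \<comment> \<open>The scalar \<open>\<epsilon> (x * x')\<close> splits into two factors, each
    attached to the remaining leg of its own element, ready for the counit law.\<close>
  also have "\<dots> = sweedler U a (\<lambda>x y. sweedler U b (\<lambda>x' y'. \<sigma> (sm (\<epsilon> x') y') * \<sigma> (sm (\<epsilon> x) y)))"
    by (simp add: sweedler_antipode)
  also have "\<dots> = sweedler U a (\<lambda>x y. \<sigma> (sweedler U b (\<lambda>x' y'. sm (\<epsilon> x') y')) * \<sigma> (sm (\<epsilon> x) y))"
    by (subst sweedler_additive[of \<sigma>], simp) (simp only: sweedler_mult_right)
  also have "\<dots> = \<sigma> b * \<sigma> (sweedler U a (\<lambda>x y. sm (\<epsilon> x) y))"
    by (subst sweedler_additive[of \<sigma>], simp) (simp only: sweedler_mult_left sweedler_counit)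
  finally show ?thesis using Z1 by (simp only: sweedler_counit)
qed

section \<open>The adjoint action as a representation\<close>

lemma ad_L_sweedler: "ad_L U a v = sweedler U a (\<lambda>x y. x * v * \<sigma> y)"
  by (simp add: ad_L_def sweedler_def)

text \<open>This makes \<open>ad_L\<close> independent of the representative of the coproduct, so
  the coproduct identities may be used inside it.\<close>

lemma balanced2_ad_L: "balanced2 sm (\<lambda>x y. x * v * \<sigma> y)"
  by (simp add: balanced2_def algebra_simps)

lemma ad_L_add: "ad_L U (a + b) v = ad_L U a v + ad_L U b v"
  by (simp add: ad_L_sweedler sweedler_of_add[OF balanced2_ad_L])

lemma ad_L_smult: "ad_L U (sm c a) v = sm c (ad_L U a v)"
  by (simp add: ad_L_sweedler sweedler_of_smult[OF balanced2_ad_L] sweedler_smult)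

text \<open>Termwise, \<open>x * x' * v * \<sigma> (y * y')\<close> equals
  \<open>x * (x' * v * \<sigma> y') * \<sigma> y\<close>, because the antipode reverses
  products.\<close>

lemma ad_L_mult: "ad_L U (a * b) v = ad_L U a (ad_L U b v)"
  unfolding ad_L_sweedler sweedler_of_mult[OF balanced2_ad_L]
  by (simp add: antipode_mult sweedler_mult_left sweedler_mult_right mult.assoc)

lemma ad_L_zero: "ad_L U 0 v = 0"
  by (rule additive_zero) (rule ad_L_add)

end

section \<open>Submodules generated by a vector\<close>

lemma quantum_levi_closed:
  assumes "hopf_algebra U"
  shows "module.subspace (smult U) (quantum_levi U g S)"
    and "1 \<in> quantum_levi U g S"
    and "a \<in> quantum_levi U g S \<Longrightarrow> b \<in> quantum_levi U g S \<Longrightarrow> a * b \<in> quantum_levi U g S"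
proof -
  interpret hopf U by unfold_locales (rule assms)
  show "module.subspace (smult U) (quantum_levi U g S)"
    unfolding quantum_levi_def hopf_generated_def
    by (rule subspace_Inter) (auto simp: hopf_subalgebra_def)
qed (auto simp: quantum_levi_def hopf_generated_def hopf_subalgebra_def)

lemma submodule_cyclic_adjoint_module:
  assumes "hopf_algebra U"
  shows "submodule (quantum_levi U g S) (adjoint_module U) (cyclic_adjoint_module U g S v)"
proof -
  interpret hopf U by unfold_locales (rule assms)
  note L = quantum_levi_closed[OF assms, where g = g and S = S]
  have "subspace (cyclic_adjoint_module U g S v)"
    unfolding cyclic_adjoint_module_def
  proof (rule subspaceI)
    show "0 \<in> {ad_L U a v |a. a \<in> quantum_levi U g S}"
      using subspace_0[OF L(1)] ad_L_zero[of v, symmetric] by blast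
    show "x + y \<in> {ad_L U a v |a. a \<in> quantum_levi U g S}"
      if "x \<in> {ad_L U a v |a. a \<in> quantum_levi U g S}" "y \<in> {ad_L U a v |a. a \<in> quantum_levi U g S}"
      for x y
      using that subspace_add[OF L(1)] by (auto simp: ad_L_add[symmetric])
    show "sm c x \<in> {ad_L U a v |a. a \<in> quantum_levi U g S}"
      if "x \<in> {ad_L U a v |a. a \<in> quantum_levi U g S}" for c x
      using that subspace_scale[OF L(1)] by (auto simp: ad_L_smult[symmetric])
  qed
  moreover have "ad_L U a x \<in> cyclic_adjoint_module U g S v"
    if "a \<in> quantum_levi U g S" "x \<in> cyclic_adjoint_module U g S v" for a x
    using that L(3) by (auto simp: cyclic_adjoint_module_def ad_L_mult[symmetric])
  ultimately show ?thesis by (auto simp: submodule_def adjoint_module_def)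
qed

lemma submodule_orbit:
  assumes U: "hopf_algebra U" and V: "left_module U (quantum_levi U g S) V"
  shows "submodule (quantum_levi U g S) V {action V a w | a. a \<in> quantum_levi U g S}"
proof -
  interpret hopf U by unfold_locales (rule U)
  interpret V: vector_space "vscale V" using V by (simp add: left_module_def)
  note L = quantum_levi_closed[OF U, where g = g and S = S]
  have add: "action V (a + b) w = action V a w + action V b w"
    if "a \<in> quantum_levi U g S" "b \<in> quantum_levi U g S" for a b
    using V that by (simp add: left_module_def)
  have scale: "action V (sm c a) w = vscale V c (action V a w)"
    if "a \<in> quantum_levi U g S" for c a
    using V that by (simp add: left_module_def)
  have mult: "action V (a * b) w = action V a (action V b w)"
    if "a \<in> quantum_levi U g S" "b \<in> quantum_levi U g S" for a b
    using V that by (simp add: left_module_def)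
  have zero: "action V 0 w = 0"
    using add[of 0 0] subspace_0[OF L(1)] by simp
  have "V.subspace {action V a w | a. a \<in> quantum_levi U g S}"
  proof (rule V.subspaceI)
    show "0 \<in> {action V a w | a. a \<in> quantum_levi U g S}"
      using subspace_0[OF L(1)] zero[symmetric] by blast
    show "x + y \<in> {action V a w | a. a \<in> quantum_levi U g S}"
      if "x \<in> {action V a w | a. a \<in> quantum_levi U g S}"
        "y \<in> {action V a w | a. a \<in> quantum_levi U g S}" for x y
    proof -
      from that obtain a b where "x = action V a w" "y = action V b w"
        "a \<in> quantum_levi U g S" "b \<in> quantum_levi U g S" by blast
      with add[of a b, symmetric] subspace_add[OF L(1), of a b] show ?thesis by auto
    qed
    show "vscale V c x \<in> {action V a w | a. a \<in> quantum_levi U g S}"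
      if "x \<in> {action V a w | a. a \<in> quantum_levi U g S}" for c x
    proof -
      from that obtain a where "x = action V a w" "a \<in> quantum_levi U g S" by blast
      with scale[of a c, symmetric] subspace_scale[OF L(1), of a c] show ?thesis by auto
    qed
  qed
  moreover have "action V a x \<in> {action V a w | a. a \<in> quantum_levi U g S}"
    if a: "a \<in> quantum_levi U g S" and x: "x \<in> {action V a w | a. a \<in> quantum_levi U g S}" for a x
  proof -
    from x obtain b where "x = action V b w" "b \<in> quantum_levi U g S" by blast
    with a mult[of a b, symmetric] L(3)[of a b] show ?thesis by auto
  qed
  ultimately show ?thesis by (simp add: submodule_def)
qed

text \<open>The orbit is a submodule containing \<open>w\<close>, since 1 acts as the identity; it
  is nonzero, so irreducibility leaves only the whole module.\<close>

lemma irreducible_orbit: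
  assumes "hopf_algebra U" and V: "left_module U (quantum_levi U g S) V"
    and "irreducible_module (quantum_levi U g S) V" and "w \<noteq> 0"
  shows "{action V a w | a. a \<in> quantum_levi U g S} = UNIV"
proof -
  have "action V 1 w = w" using V by (simp add: left_module_def)
  then have "w \<in> {action V a w | a. a \<in> quantum_levi U g S}"
    using quantum_levi_closed(2)[OF assms(1), where g = g and S = S] by force
  then show ?thesis
    using submodule_orbit[OF assms(1,2), of w] assms(3,4)
    unfolding irreducible_module_def by blast
qed

text \<open>A finite basis is pulled back along \<open>\<phi>\<close>. Since \<open>\<phi>\<close>
  is linear only on \<open>M\<close>, every vector involved has to be kept inside \<open>M\<close>.
  This supplies local finiteness for embeddings.\<close>

lemma finite_dimensional_linear_iso:
  assumes "vector_space sm" and "vector_space sm'"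
    and M: "module.subspace sm M" and \<phi>: "bij_betw \<phi> M N"
    and add: "\<forall>v\<in>M. \<forall>w\<in>M. \<phi> (v + w) = \<phi> v + \<phi> w"
    and scale: "\<forall>c. \<forall>v\<in>M. \<phi> (sm c v) = sm' c (\<phi> v)"
    and N: "finite_dimensional sm' N" and N_sub: "module.subspace sm' N"
  shows "finite_dimensional sm M"
proof -
  interpret X: vector_space sm by fact
  interpret Y: vector_space sm' by fact
  \<comment> \<open>The finite spanning set given by \<open>finite_dimensional\<close> may lie
    outside \<open>N\<close>; a basis inside \<open>N\<close> has preimages in \<open>M\<close>, and
    independence makes it finite.\<close>
  obtain B where B: "B \<subseteq> N" "Y.independent B" "Y.span B = N"
    using Y.basis_exists[of N] Y.span_subspace[OF _ _ N_sub] by metis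
  obtain B' where "finite B'" "N \<subseteq> Y.span B'" using N by (auto simp: finite_dimensional_def)
  then have "finite B"
    using B by (meson Y.independent_span_bound subset_trans)
  define C where "C = inv_into M \<phi> ` B"
  have inv: "inv_into M \<phi> b \<in> M" "\<phi> (inv_into M \<phi> b) = b" if "b \<in> B" for b
    using that B(1) \<phi> by (auto simp: bij_betw_def inv_into_into f_inv_into_f)
  have C: "X.span C \<subseteq> M"
    using inv(1) by (intro X.span_minimal M) (auto simp: C_def)
  have zero: "\<phi> 0 = 0" using add X.subspace_0[OF M] by force
  \<comment> \<open>The image of the span is a subspace containing the basis \<open>B\<close>, hence
    all of \<open>N\<close>; injectivity of \<open>\<phi>\<close> on \<open>M\<close> then forces
    \<open>M\<close> into the span of \<open>C\<close>.\<close>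
  have "Y.subspace (\<phi> ` X.span C)"
  proof (rule Y.subspaceI)
    show "0 \<in> \<phi> ` X.span C" using zero X.span_zero by (metis imageI)
    show "x + y \<in> \<phi> ` X.span C" if "x \<in> \<phi> ` X.span C" "y \<in> \<phi> ` X.span C" for x y
    proof -
      from that obtain u v where uv: "x = \<phi> u" "y = \<phi> v" "u \<in> X.span C" "v \<in> X.span C" by blast
      then have "x + y = \<phi> (u + v)" using add C by (simp add: subset_iff)
      then show ?thesis using X.span_add uv by blast
    qed
    show "sm' c x \<in> \<phi> ` X.span C" if "x \<in> \<phi> ` X.span C" for c x
    proof -
      from that obtain u where u: "x = \<phi> u" "u \<in> X.span C" by blast
      then have "sm' c x = \<phi> (sm c u)" using scale C by (simp add: subset_iff)
      then show ?thesis using X.span_scale u by blast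
    qed
  qed
  moreover have "B \<subseteq> \<phi> ` X.span C"
    using inv(2) by (force simp: C_def intro: X.span_base)
  ultimately have "N \<subseteq> \<phi> ` X.span C" using Y.span_minimal B(3) by blast
  then have "M \<subseteq> X.span C"
    using C \<phi> by (auto simp: bij_betw_def inj_on_def)
  moreover have "finite C" using \<open>finite B\<close> by (simp add: C_def)
  ultimately show ?thesis unfolding finite_dimensional_def by blast
qed

lemma embedding_is_cyclic:
  fixes V :: "('k::field, 'u::ring_1, 'v::ab_group_add) lmodule"
  assumes U: "hopf_algebra U" and V: "left_module U (quantum_levi U g S) V"
    and irr: "irreducible_module (quantum_levi U g S) V"
    and fin: "finite_dimensional (vscale V) UNIV"
    and M: "M \<in> embeddings_of_type U g S V"
  obtains v where "v \<in> locally_finite_part_of_type U g S V" "M = cyclic_adjoint_module U g S v"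
proof -
  let ?L = "quantum_levi U g S"
  from M have sub: "module.subspace (smult U) M" "\<And>a v. a \<in> ?L \<Longrightarrow> v \<in> M \<Longrightarrow> ad_L U a v \<in> M"
    and iso: "module_iso ?L (adjoint_module U) M V UNIV"
    by (auto simp: embeddings_of_type_def submodule_def adjoint_module_def)
  from iso obtain \<phi> where \<phi>: "bij_betw \<phi> M UNIV"
    "\<forall>v\<in>M. \<forall>w\<in>M. \<phi> (v + w) = \<phi> v + \<phi> w"
    "\<forall>c. \<forall>v\<in>M. \<phi> (smult U c v) = vscale V c (\<phi> v)"
    "\<forall>a\<in>?L. \<forall>v\<in>M. \<phi> (ad_L U a v) = action V a (\<phi> v)"
    by (auto simp: module_iso_def adjoint_module_def)
  interpret hopf U by unfold_locales (rule U)
  interpret V: vector_space "vscale V" using V by (simp add: left_module_def)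
  have fin_M: "finite_dimensional (smult U) M"
    by (rule finite_dimensional_linear_iso[OF _ _ sub(1) \<phi>(1-3) fin])
      (auto intro: vector_space_axioms V.vector_space_axioms)
  \<comment> \<open>Any nonzero vector of \<open>V\<close> serves; its preimage \<open>v\<close>
    will be the generator.\<close>
  obtain w :: 'v where w: "w \<noteq> 0" using irr by (auto simp: irreducible_module_def)
  obtain v where v: "v \<in> M" "\<phi> v = w" using \<phi>(1) by (metis bij_betw_def UNIV_I imageE)
  have sub_v: "cyclic_adjoint_module U g S v \<subseteq> M"
    using sub(2) v(1) by (auto simp: cyclic_adjoint_module_def)
  \<comment> \<open>Some \<open>a\<close> carries \<open>w\<close> to \<open>\<phi> m\<close>;
    equivariance and injectivity of \<open>\<phi>\<close> turn this into
    \<open>m = ad_L U a v\<close>.\<close>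
  have "m \<in> cyclic_adjoint_module U g S v" if m: "m \<in> M" for m
  proof -
    obtain a where a: "a \<in> ?L" "\<phi> m = action V a w"
      using irreducible_orbit[OF U V irr w] by blast
    then have "\<phi> m = \<phi> (ad_L U a v)" using \<phi>(4) v by simp
    then have "m = ad_L U a v"
      using \<phi>(1) m sub(2)[OF a(1) v(1)] by (auto simp: bij_betw_def inj_on_def)
    then show ?thesis using a(1) by (auto simp: cyclic_adjoint_module_def)
  qed
  then have "M = cyclic_adjoint_module U g S v" using sub_v by blast
  \<comment> \<open>As \<open>M\<close> is the cyclic module of \<open>v\<close>, its finite
    dimension and its isomorphism with \<open>V\<close> are exactly the two conditions on
    \<open>v\<close>.\<close>
  then show ?thesis
    using that[of v] fin_M iso
    by (auto simp: locally_finite_part_of_type_def locally_finite_part_def)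
qed

theorem proposition9:
  fixes sc :: "complex \<Rightarrow> 'g::ab_group_add \<Rightarrow> 'g" and br :: "'g \<Rightarrow> 'g \<Rightarrow> 'g"
    and h :: "'g set" and \<alpha> :: "'i::finite \<Rightarrow> 'g \<Rightarrow> complex" and d :: "'i \<Rightarrow> nat"
    and q :: "'k::field_char_0" and U :: "('k, 'u::ring_1) hopf" and g :: "'i uq_gen \<Rightarrow> 'u"
    and S :: "'i set" and lam :: "'g \<Rightarrow> complex"
    and V :: "('k, 'u, 'v::ab_group_add) lmodule"
  assumes lie: "semisimple_lie_algebra sc br h \<alpha>"
    and d: "semisimple_lie_algebra.symmetrizer sc br h \<alpha> d"
    and q: "q \<noteq> 0" "\<forall>n>0. q ^ n \<noteq> 1"
    and U: "quantized_enveloping_algebra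
              (semisimple_lie_algebra.cartan_matrix sc br h \<alpha>) d q U g"
    and dominant: "lam \<in> semisimple_lie_algebra.dominant_weights sc br h \<alpha>"
    and V: "is_irreducible_highest_weight_module q U g S
              (semisimple_lie_algebra.weight_pairing sc br h \<alpha> d lam) V"
  shows "bij_betw (\<lambda>M. M) (embeddings_of_type U g S V)
           {cyclic_adjoint_module U g S v | v. v \<in> locally_finite_part_of_type U g S V}"
proof -
  let ?cyclic = "{cyclic_adjoint_module U g S v | v. v \<in> locally_finite_part_of_type U g S V}"
  have hopf: "hopf_algebra U" using U by (simp add: quantized_enveloping_algebra_def)
  \<comment> \<open>The map is the identity on submodules, so bijectivity amounts to equality of the
    two sets.\<close>
  have "embeddings_of_type U g S V \<subseteq> ?cyclic"
    using V embedding_is_cyclic[OF hopf]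
    unfolding is_irreducible_highest_weight_module_def by blast
  \<comment> \<open>The isomorphism with \<open>V\<close> is part of the condition on
    \<open>v\<close>; what has to be supplied is that the cyclic module is a submodule.\<close>
  moreover have "?cyclic \<subseteq> embeddings_of_type U g S V"
    using submodule_cyclic_adjoint_module[OF hopf]
    by (auto simp: embeddings_of_type_def locally_finite_part_of_type_def)
  ultimately show ?thesis by (simp add: bij_betw_def)
qed

end
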